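(* Let $n\ge 1$. The bookshelf construction $T\mapsto B(T)$ is a bijection from the set of binary trees with $n+1$ leaves to the set of Young diagrams $\lambda=(\lambda_1\ge\lambda_2\ge\cdots)$ satisfying $\lambda_i+i\le n$ for all $1\le i\le n$ (so in particular $\lambda_i=0$ for all $i\ge n$).
   Context: A binary tree is a finite planar rooted tree in which every internal node has exactly two children (a left child and a right child). A Young diagram is a weakly decreasing sequence $\lambda_1\ge\lambda_2\ge\cdots\ge 0$ of integers with finitely many nonzero terms, where $\lambda_i$ is the number of boxes in row $i$; the empty diagram is allowed. Coordinates. Let $T$ be a binary tree with $n+1$ leaves, drawn so that all leaves lie on the bottom level. A node $v$ of $T$ (internal or leaf) has coordinates $(m,k)$, where $m$ is the number of leaves of $T$ strictly to the right of all leaves of the subtree rooted at $v$, and $k$ is the number of leaves of $T$ strictly to the left of all leaves of that subtree. Thus the root is at $(0,0)$ and leaves are at the points $(m,n-m)$, $0\le m\le n$. Edges to right children are descending (they keep the first coordinate $m$ constant), and edges to left children are ascending (read from left to right; they keep the second coordinate constant). Shelves. A maximal descending segment of $T$ with constant first coordinate $m$ runs from a point $(m,k)$ to the leaf $(m,n-m)$. The one with $m=0$ (starting at the root) is called the ceiling. Those of positive length with $m\ge 1$ are called shelves; equivalently, a shelf with first coordinate $m\ge1$ starts at the highest node whose subtree's rightmost leaf is $(m,n-m)$, when that node is not itself the leaf. Bookshelf construction. Let the cell $(i,c)$ (row $i\ge1$, column $c\ge1$) be the unit square with corners $(i-1,c-1),(i-1,c),(i,c-1),(i,c)$. For each shelf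 from $(m,k)$ to $(m,n-m)$, fill in all cells $(i,c)$ with $1\le i\le m$ and $k+1\le c\le n-m$ (all cells above the shelf up to the ceiling). Take the union of these sets of cells over all shelves, and then push the cells of each row to the left so as to eliminate gaps. The result is a Young diagram $B(T)$: its $i$-th row length is the number of filled cells in row $i$. *)

theory Defs
  imports Main "HOL-Library.Tree" "HOL-Library.Sublist"
begin

type_synonym binary_tree = "unit tree"

text \<open>A node is addressed by the path of child directions leading to it from the root.\<close>

datatype dir = Left | Right

fun nodes :: "binary_tree \<Rightarrow> dir list set" where
  "nodes \<langle>\<rangle> = {[]}"
| "nodes \<langle>l, x, r\<rangle> = insert [] ((#) Left ` nodes l \<union> (#) Right ` nodes r)"

fun leaves :: "binary_tree \<Rightarrow> dir list set" where
  "leaves \<langle>\<rangle> = {[]}"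
| "leaves \<langle>l, x, r\<rangle> = (#) Left ` leaves l \<union> (#) Right ` leaves r"

definition left_of :: "dir list \<Rightarrow> dir list \<Rightarrow> bool" where
  "left_of p q \<longleftrightarrow> (\<exists>u p' q'. p = u @ Left # p' \<and> q = u @ Right # q')"

definition leaves_below :: "binary_tree \<Rightarrow> dir list \<Rightarrow> dir list set" where
  "leaves_below T v = {p \<in> leaves T. prefix v p}"

definition coords :: "binary_tree \<Rightarrow> dir list \<Rightarrow> nat \<times> nat" where
  "coords T v =
     (card {q \<in> leaves T. \<forall>p \<in> leaves_below T v. left_of p q},
      card {q \<in> leaves T. \<forall>p \<in> leaves_below T v. left_of q p})"

text \<open>A segment is given by its upper endpoint \<open>v\<close> and its lower endpoint \<open>w\<close>;
  edges to right children are the descending ones.\<close>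

definition descending_segment :: "binary_tree \<Rightarrow> dir list \<Rightarrow> dir list \<Rightarrow> bool" where
  "descending_segment T v w \<longleftrightarrow>
     v \<in> nodes T \<and> w \<in> nodes T \<and> (\<exists>j. w = v @ replicate j Right)"

definition maximal_descending_segment :: "binary_tree \<Rightarrow> dir list \<Rightarrow> dir list \<Rightarrow> bool" where
  "maximal_descending_segment T v w \<longleftrightarrow>
     descending_segment T v w \<and>
     (\<forall>v' w'. descending_segment T v' w' \<and> prefix v' v \<and> prefix w w' \<longrightarrow> v' = v \<and> w' = w)"

definition is_shelf :: "binary_tree \<Rightarrow> dir list \<Rightarrow> dir list \<Rightarrow> bool" where
  "is_shelf T v w \<longleftrightarrow>
     maximal_descending_segment T v w \<and> v \<noteq> w \<and> fst (coords T v) \<ge> 1"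

text \<open>Note that \<open>size T\<close> counts internal nodes, so it is the \<open>n\<close> of a tree with \<open>n + 1\<close> leaves.
  The shelf ends at the leaf with coordinates \<open>(m, n - m)\<close>. Cells are pairs (row, column),
  both numbered from 1.\<close>

definition shelf_cells :: "binary_tree \<Rightarrow> dir list \<Rightarrow> (nat \<times> nat) set" where
  "shelf_cells T v =
     (let (m, k) = coords T v; n = size T
      in {(i, c). 1 \<le> i \<and> i \<le> m \<and> k + 1 \<le> c \<and> c \<le> n - m})"

definition filled_cells :: "binary_tree \<Rightarrow> (nat \<times> nat) set" where
  "filled_cells T = (\<Union>v \<in> {v. \<exists>w. is_shelf T v w}. shelf_cells T v)"

definition bookshelf :: "binary_tree \<Rightarrow> nat \<Rightarrow> nat" where
  "bookshelf T i = card {c. (i, c) \<in> filled_cells T}"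

text \<open>Rows are numbered from 1; the value at index 0 is meaningless and is fixed to 0, so that
  different functions are different diagrams.\<close>

definition young_diagram :: "(nat \<Rightarrow> nat) \<Rightarrow> bool" where
  "young_diagram d \<longleftrightarrow>
     d 0 = 0 \<and> (\<forall>i j. 1 \<le> i \<and> i \<le> j \<longrightarrow> d j \<le> d i) \<and> finite {i. d i \<noteq> 0}"

definition bounded_diagrams :: "nat \<Rightarrow> (nat \<Rightarrow> nat) set" where
  "bounded_diagrams n = {d. young_diagram d \<and> (\<forall>i. 1 \<le> i \<and> i \<le> n \<longrightarrow> d i + i \<le> n)}"

end

theory Submission imports Defs begin

text \<open>Column \<open>c\<close> corresponds to the \<open>c\<close>-th internal node \<open>v\<close> in inorder. Among the shelves over
  this column, counting the ceiling as one, the one through \<open>v\<close> has the largest first coordinate, so row \<open>i \<ge> 1\<close> of the bookshelf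
  counts the internal nodes whose first coordinate is at least \<open>i\<close>. If this count is extended to
  \<open>i = 0\<close> by the number of all internal nodes, a tree \<open>\<langle>l, (), r\<rangle>\<close> with \<open>n\<close> internal nodes has
  \<open>g i = g\<^sub>r i + g\<^sub>l (i - size1 r)\<close> for \<open>i \<ge> 1\<close>. Here \<open>size1 r\<close> can be read off from \<open>g\<close>: it is the
  least \<open>j \<ge> 1\<close> at which the bound \<open>g j + j \<le> n\<close> is attained. This is the first return decomposition
  of a Dyck path, and it inverts the construction.\<close>

section \<open>Coordinates\<close>

lemma left_of_Nil [simp]: "\<not> left_of [] q" "\<not> left_of p []"
  by (auto simp: left_of_def)

lemma left_of_Cons [simp]:
  "left_of (a # p) (b # q) \<longleftrightarrow> a = Left \<and> b = Right \<or> a = b \<and> left_of p q"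
proof
  assume "left_of (a # p) (b # q)"
  then obtain u p' q' where "a # p = u @ Left # p'" "b # q = u @ Right # q'"
    by (auto simp: left_of_def)
  then show "a = Left \<and> b = Right \<or> a = b \<and> left_of p q"
    by (cases u) (auto simp: left_of_def)
next
  assume "a = Left \<and> b = Right \<or> a = b \<and> left_of p q"
  then show "left_of (a # p) (b # q)"
  proof
    assume "a = Left \<and> b = Right"
    then show ?thesis
      unfolding left_of_def by (metis append_Nil)
  next
    assume "a = b \<and> left_of p q"
    then show ?thesis
      unfolding left_of_def by (metis append_Cons)
  qed
qed

lemma finite_leaves [simp]: "finite (leaves T)"
  by (induction T) auto

lemma leaves_nonempty [simp]: "leaves T \<noteq> {}"
  by (induction T) auto

lemma leaves_subset_nodes: "leaves T \<subseteq> nodes T"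
  by (induction T) auto

lemma card_Left_Right:
  assumes "finite A" "finite B"
  shows "card ((#) Left ` A \<union> (#) Right ` B) = card A + card B"
  using assms by (subst card_Un_disjoint) (auto simp: card_image)

lemma card_leaves: "card (leaves T) = size1 T"
  by (induction T) (auto simp: card_Left_Right)

lemma leaves_below_Nil [simp]: "leaves_below T [] = leaves T"
  by (simp add: leaves_below_def)

lemma leaves_below_Cons [simp]:
  "leaves_below \<langle>l, x, r\<rangle> (Left # v) = (#) Left ` leaves_below l v"
  "leaves_below \<langle>l, x, r\<rangle> (Right # v) = (#) Right ` leaves_below r v"
  unfolding leaves_below_def by auto

text \<open>Guards against vacuous quantifiers in \<open>coords\<close>: with no leaf below
  \<open>v\<close>, every leaf of the tree would count as lying on both sides of
  \<open>v\<close>.\<close>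

lemma leaves_below_nonempty:
  assumes "v \<in> nodes T"
  shows "leaves_below T v \<noteq> {}"
  using assms
proof (induction T arbitrary: v)
  case (Node l x r)
  consider "v = []" | u where "v = Left # u" "u \<in> nodes l" | u where "v = Right # u" "u \<in> nodes r"
    using Node.prems by auto
  then show ?case
    using Node.IH by cases (simp_all del: leaves.simps)
qed simp

lemma coords_Nil [simp]: "coords T [] = (0, 0)"
proof -
  have "left_of p p \<Longrightarrow> False" for p
    by (induction p) auto
  then have "{q \<in> leaves T. \<forall>p \<in> leaves T. left_of p q} = {}"
    "{q \<in> leaves T. \<forall>p \<in> leaves T. left_of q p} = {}"
    by blast+
  then show ?thesis
    by (simp add: coords_def)
qed

text \<open>All leaves of \<open>r\<close> lie to the right of everything in \<open>l\<close>, so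
  they add to the first coordinate only.\<close>

lemma coords_Left:
  assumes "v \<in> nodes l"
  shows "coords \<langle>l, x, r\<rangle> (Left # v) = (fst (coords l v) + size1 r, snd (coords l v))"
proof -
  let ?B = "leaves_below l v"
  have "{q \<in> leaves \<langle>l, x, r\<rangle>. \<forall>p \<in> (#) Left ` ?B. left_of p q} =
      (#) Left ` {q \<in> leaves l. \<forall>p \<in> ?B. left_of p q} \<union> (#) Right ` leaves r"
    by auto
  moreover have "{q \<in> leaves \<langle>l, x, r\<rangle>. \<forall>p \<in> (#) Left ` ?B. left_of q p} =
      (#) Left ` {q \<in> leaves l. \<forall>p \<in> ?B. left_of q p}"
    using leaves_below_nonempty[OF assms] by auto
  ultimately show ?thesis
    unfolding coords_def leaves_below_Cons by (simp add: card_Left_Right card_leaves card_image)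
qed

lemma coords_Right:
  assumes "v \<in> nodes r"
  shows "coords \<langle>l, x, r\<rangle> (Right # v) = (fst (coords r v), snd (coords r v) + size1 l)"
proof -
  let ?B = "leaves_below r v"
  have "{q \<in> leaves \<langle>l, x, r\<rangle>. \<forall>p \<in> (#) Right ` ?B. left_of q p} =
      (#) Left ` leaves l \<union> (#) Right ` {q \<in> leaves r. \<forall>p \<in> ?B. left_of q p}"
    by auto
  moreover have "{q \<in> leaves \<langle>l, x, r\<rangle>. \<forall>p \<in> (#) Right ` ?B. left_of p q} =
      (#) Right ` {q \<in> leaves r. \<forall>p \<in> ?B. left_of p q}"
    using leaves_below_nonempty[OF assms] by auto
  ultimately show ?thesis
    unfolding coords_def leaves_below_Cons by (simp add: card_Left_Right card_leaves card_image)
qed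

text \<open>Ensures that natural subtraction of a first coordinate from the size never truncates
  when column intervals are shifted.\<close>

lemma coords_sum_le:
  assumes "v \<in> nodes T"
  shows "fst (coords T v) + snd (coords T v) \<le> size T"
  using assms
proof (induction T arbitrary: v)
  case (Node l x r)
  consider "v = []" | u where "v = Left # u" "u \<in> nodes l" | u where "v = Right # u" "u \<in> nodes r"
    using Node.prems by auto
  then show ?case
  proof cases
    case 2
    with Node.IH(1)[of u] show ?thesis
      by (simp add: coords_Left size1_size)
  next
    case 3
    with Node.IH(2)[of u] show ?thesis
      by (simp add: coords_Right size1_size)
  qed simp
qed simp

lemma coords_sum_leaf:
  assumes "v \<in> leaves T"
  shows "fst (coords T v) + snd (coords T v) = size T"
  using assms
proof (induction T arbitrary: v)
  case (Node l x r)
  consider u where "v = Left # u" "u \<in> leaves l" | u where "v = Right # u" "u \<in> leaves r"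
    using Node.prems by auto
  then show ?case
  proof cases
    case 1
    moreover have "u \<in> nodes l"
      using 1 leaves_subset_nodes by blast
    ultimately show ?thesis
      using Node.IH(1)[of u] by (simp add: coords_Left size1_size)
  next
    case 2
    moreover have "u \<in> nodes r"
      using 2 leaves_subset_nodes by blast
    ultimately show ?thesis
      using Node.IH(2)[of u] by (simp add: coords_Right size1_size)
  qed
qed simp

lemma nodes_prefix_closed:
  assumes "p @ q \<in> nodes T"
  shows "p \<in> nodes T"
  using assms
proof (induction T arbitrary: p)
  case (Node l x r)
  then show ?case by (cases p) auto
qed simp

text \<open>A step to a right child keeps the rightmost leaf of the subtree and can only leave more
  leaves on the left.\<close>

lemma coords_replicate_Right:
  assumes "v @ replicate j Right \<in> nodes T"
  shows "fst (coords T (v @ replicate j Right)) = fst (coords T v) \<and>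
    snd (coords T v) \<le> snd (coords T (v @ replicate j Right))"
  using assms
proof (induction T arbitrary: v j)
  case Leaf
  then show ?case by simp
next
  case (Node l x r)
  show ?case
  proof (cases v)
    case Nil
    show ?thesis
    proof (cases j)
      case 0
      with Nil show ?thesis by simp
    next
      case (Suc k)
      with Nil Node.prems have "[] @ replicate k Right \<in> nodes r"
        by auto
      with Node.IH(2)[of "[]" k] show ?thesis
        using Nil Suc by (simp add: coords_Right)
    qed
  next
    case (Cons a u)
    show ?thesis
    proof (cases a)
      case Left
      with Cons Node.prems have "u @ replicate j Right \<in> nodes l"
        by auto
      with Node.IH(1)[of u j] nodes_prefix_closed show ?thesis
        using Cons Left by (simp add: coords_Left)
    next
      case Right
      with Cons Node.prems have "u @ replicate j Right \<in> nodes r"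
        by auto
      with Node.IH(2)[of u j] nodes_prefix_closed show ?thesis
        using Cons Right by (simp add: coords_Right)
    qed
  qed
qed

section \<open>Rows of the bookshelf\<close>

text \<open>Letting \<open>v\<close> range over all nodes, not only tops of shelves, makes the set
  recursive in the tree. Row 0 is allowed and is covered by the ceiling.\<close>

definition columns_above :: "binary_tree \<Rightarrow> nat \<Rightarrow> nat set" where
  "columns_above T i = (\<Union>v \<in> nodes T.
     {c. i \<le> fst (coords T v) \<and> snd (coords T v) < c \<and> c \<le> size T - fst (coords T v)})"

section \<open>Descending segments and their upper ends\<close>

lemma leaf_maximal:
  assumes "p \<in> leaves T" "p @ q \<in> nodes T"
  shows "q = []"
  using assms by (induction T arbitrary: p) auto

lemma ex_leaf_replicate_Right:
  assumes "v \<in> nodes T"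
  shows "\<exists>j. v @ replicate j Right \<in> leaves T"
  using assms
proof (induction T arbitrary: v)
  case Leaf
  then show ?case by (auto intro: exI[of _ 0])
next
  case (Node l x r)
  consider "v = []" | u where "v = Left # u" "u \<in> nodes l" | u where "v = Right # u" "u \<in> nodes r"
    using Node.prems by auto
  then show ?case
  proof cases
    case 1
    have "[] \<in> nodes r"
      by (cases r) auto
    then obtain j where "[] @ replicate j Right \<in> leaves r"
      using Node.IH(2) by blast
    with 1 have "v @ replicate (Suc j) Right \<in> leaves \<langle>l, x, r\<rangle>"
      by simp
    then show ?thesis ..
  next
    case 2
    with Node.IH(1)[of u] show ?thesis
      by auto
  next
    case 3
    with Node.IH(2)[of u] show ?thesis
      by auto
  qed
qed

lemma ex_replicate_Right_decomp:
  "\<exists>u j. v = u @ replicate j Right \<and> (\<forall>u'. u \<noteq> u' @ [Right])"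
proof (induction v rule: rev_induct)
  case Nil
  then show ?case by simp
next
  case (snoc a v)
  show ?case
  proof (cases a)
    case Left
    then show ?thesis
      by (intro exI[of _ "v @ [a]"] exI[of _ 0]) simp
  next
    case Right
    from snoc obtain u j where "v = u @ replicate j Right" "\<forall>u'. u \<noteq> u' @ [Right]"
      by blast
    with Right show ?thesis
      by (intro exI[of _ u] exI[of _ "Suc j"]) (simp add: replicate_append_same)
  qed
qed

text \<open>The segment cannot be prolonged downwards because it ends in a leaf, nor upwards because
  \<open>u\<close> is the root or a left child.\<close>

lemma maximal_descending_segmentI:
  assumes "u \<in> nodes T" "u @ replicate j Right \<in> leaves T" "\<And>u'. u \<noteq> u' @ [Right]"
  shows "maximal_descending_segment T u (u @ replicate j Right)"
  unfolding maximal_descending_segment_def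
proof (intro conjI allI impI)
  show "descending_segment T u (u @ replicate j Right)"
    using assms leaves_subset_nodes unfolding descending_segment_def by blast
next
  fix v' w'
  assume *: "descending_segment T v' w' \<and> prefix v' u \<and> prefix (u @ replicate j Right) w'"
  then show w': "w' = u @ replicate j Right"
    using leaf_maximal[OF assms(2)] unfolding prefix_def descending_segment_def by auto
  from * obtain z where z: "u = v' @ z"
    unfolding prefix_def by blast
  from * obtain k where "w' = v' @ replicate k Right"
    unfolding descending_segment_def by blast
  with w' z have eq: "z @ replicate j Right = replicate k Right"
    by simp
  \<comment> \<open>By \<open>eq\<close>, a nonempty \<open>z\<close> would end in
    \<open>Right\<close>, and then so would \<open>u\<close>.\<close>
  have "z = []"
  proof (cases z rule: rev_cases)
    case (snoc y a)
    have "a \<in> set (replicate k Right)"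
      using snoc by (simp flip: eq)
    then have "a = Right"
      by (simp split: if_splits)
    with snoc z assms(3)[of "v' @ y"] show ?thesis
      by simp
  qed
  with z show "v' = u"
    by simp
qed

text \<open>The upper end of the descending segment through a node has the same first coordinate and
  covers at least the same columns, so other nodes add no cells. The ceiling has first coordinate 0
  and does not reach row \<open>i\<close>.\<close>

lemma filled_row_eq_columns_above:
  assumes "i \<ge> 1"
  shows "{c. (i, c) \<in> filled_cells T} = columns_above T i"
proof (intro set_eqI iffI)
  fix c
  assume "c \<in> {c. (i, c) \<in> filled_cells T}"
  then show "c \<in> columns_above T i"
    unfolding filled_cells_def columns_above_def shelf_cells_def is_shelf_def
      maximal_descending_segment_def descending_segment_def
    by (fastforce simp: Let_def case_prod_unfold)
next
  fix c
  assume "c \<in> columns_above T i"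
  then obtain v where v: "v \<in> nodes T" "i \<le> fst (coords T v)" "snd (coords T v) < c"
    "c \<le> size T - fst (coords T v)"
    by (auto simp: columns_above_def)
  obtain u j where u: "v = u @ replicate j Right" "\<And>u'. u \<noteq> u' @ [Right]"
    using ex_replicate_Right_decomp by blast
  have un: "u \<in> nodes T"
    using v(1) u(1) nodes_prefix_closed by blast
  have cu: "fst (coords T v) = fst (coords T u)" "snd (coords T u) \<le> snd (coords T v)"
    using coords_replicate_Right v(1) u(1) by blast+
  obtain k where k: "u @ replicate k Right \<in> leaves T"
    using ex_leaf_replicate_Right[OF un] by blast
  \<comment> \<open>At a leaf the coordinates sum to \<open>size T\<close>, so its column interval
    is empty and cannot contain \<open>c\<close>. Hence the segment has positive length.\<close>
  have "u \<notin> leaves T"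
    using coords_sum_leaf[of u T] v cu by auto
  then have "is_shelf T u (u @ replicate k Right)"
    using maximal_descending_segmentI[OF un k u(2)] k v(2) cu(1) assms
    unfolding is_shelf_def by (cases k) auto
  moreover have "(i, c) \<in> shelf_cells T u"
    using v cu assms unfolding shelf_cells_def by (simp add: case_prod_unfold Let_def)
  ultimately show "c \<in> {c. (i, c) \<in> filled_cells T}"
    unfolding filled_cells_def by blast
qed

section \<open>Recursion for the rows along the tree\<close>

lemma columns_above_subset: "columns_above T i \<subseteq> {1..size T}"
  unfolding columns_above_def by auto

lemma columns_above_Leaf [simp]: "columns_above \<langle>\<rangle> i = {}"
  by (auto simp: columns_above_def)

lemma columns_above_0: "columns_above T 0 = {1..size T}"
proof
  have "[] \<in> nodes T"
    by (cases T) auto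
  then show "{1..size T} \<subseteq> columns_above T 0"
    unfolding columns_above_def by force
qed (rule columns_above_subset)

text \<open>The subtree \<open>l\<close> sits \<open>size1 r\<close> rows lower, and
  \<open>r\<close> sits \<open>size1 l\<close> columns further right. The root has first coordinate
  0, so it covers nothing in row \<open>i\<close>.\<close>

lemma columns_above_Node:
  assumes "i \<ge> 1"
  shows "columns_above \<langle>l, x, r\<rangle> i =
    columns_above l (i - size1 r) \<union> (+) (size1 l) ` columns_above r i"
proof -
  let ?I = "\<lambda>T v i. {c. i \<le> fst (coords T v) \<and> snd (coords T v) < c \<and> c \<le> size T - fst (coords T v)}"
  have L: "?I \<langle>l, x, r\<rangle> (Left # v) i = ?I l v (i - size1 r)" if "v \<in> nodes l" for v
    using that by (auto simp: coords_Left size1_size)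
  have R: "?I \<langle>l, x, r\<rangle> (Right # v) i = (+) (size1 l) ` ?I r v i" if "v \<in> nodes r" for v
  proof (rule set_eqI)
    fix c
    have "c \<in> (+) (size1 l) ` ?I r v i \<longleftrightarrow> size1 l \<le> c \<and> c - size1 l \<in> ?I r v i"
      by (force simp: image_iff intro: bexI[of _ "c - size1 l"])
    then show "c \<in> ?I \<langle>l, x, r\<rangle> (Right # v) i \<longleftrightarrow> c \<in> (+) (size1 l) ` ?I r v i"
      using coords_sum_le[OF that] by (auto simp: coords_Right[OF that] size1_size)
  qed
  have "columns_above \<langle>l, x, r\<rangle> i = ?I \<langle>l, x, r\<rangle> [] i \<union>
      (\<Union>v \<in> nodes l. ?I \<langle>l, x, r\<rangle> (Left # v) i) \<union> (\<Union>v \<in> nodes r. ?I \<langle>l, x, r\<rangle> (Right # v) i)"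
    unfolding columns_above_def by auto
  also have "?I \<langle>l, x, r\<rangle> [] i = {}"
    using assms by simp
  also have "(\<Union>v \<in> nodes l. ?I \<langle>l, x, r\<rangle> (Left # v) i) = columns_above l (i - size1 r)"
    unfolding columns_above_def using L by (intro SUP_cong) auto
  also have "(\<Union>v \<in> nodes r. ?I \<langle>l, x, r\<rangle> (Right # v) i) = (+) (size1 l) ` columns_above r i"
    unfolding columns_above_def image_UN using R by (intro SUP_cong) auto
  finally show ?thesis
    by simp
qed

text \<open>The number of internal nodes with first coordinate at least \<open>i\<close>. For \<open>i \<le> size1 r\<close> the
  truncated difference is \<open>0\<close>, so that all internal nodes of \<open>l\<close> are counted, as they should be.\<close>

fun row_length :: "binary_tree \<Rightarrow> nat \<Rightarrow> nat" where
  "row_length \<langle>\<rangle> i = 0"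
| "row_length \<langle>l, x, r\<rangle> i = of_bool (i = 0) + row_length r i + row_length l (i - size1 r)"

lemma row_length_0 [simp]: "row_length T 0 = size T"
  by (induction T) auto

lemma card_columns_above: "card (columns_above T i) = row_length T i"
proof (induction T arbitrary: i)
  case (Node l x r)
  show ?case
  proof (cases "i = 0")
    case False
    \<comment> \<open>The root's own column \<open>size1 l\<close> separates the columns of
      \<open>l\<close> from the shifted columns of \<open>r\<close>.\<close>
    have "columns_above l (i - size1 r) \<inter> (+) (size1 l) ` columns_above r i = {}"
      using columns_above_subset[of l "i - size1 r"] by (auto simp: size1_size)
    moreover have "finite (columns_above T j)" for T j
      using columns_above_subset finite_subset by blast
    ultimately show ?thesis
      using False Node by (simp add: columns_above_Node card_Un_disjoint card_image)
  qed (simp add: columns_above_0)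
qed simp

lemma bookshelf_eq_row_length: "bookshelf T = (row_length T)(0 := 0)"
proof
  fix i
  show "bookshelf T i = ((row_length T)(0 := 0)) i"
  proof (cases "i = 0")
    case True
    then have "{c. (i, c) \<in> filled_cells T} = {}"
      by (auto simp: filled_cells_def shelf_cells_def Let_def case_prod_unfold)
    with True show ?thesis
      by (simp add: bookshelf_def)
  qed (simp add: bookshelf_def filled_row_eq_columns_above card_columns_above)
qed

section \<open>The first return decomposition\<close>

text \<open>These are Dyck paths: a staircase from height \<open>n\<close> at 0 down to height 0 at
  \<open>n\<close>, staying weakly under the antidiagonal.\<close>

definition extended_diagrams :: "nat \<Rightarrow> (nat \<Rightarrow> nat) set" where
  "extended_diagrams n = {g. g 0 = n \<and> antimono g \<and> (\<forall>i \<le> n. g i + i \<le> n)}"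

lemma antimono_row_length: "antimono (row_length T)"
proof (induction T)
  case (Node l x r)
  show ?case
  proof (rule antimonoI)
    fix i j :: nat
    assume "i \<le> j"
    then have "row_length r j \<le> row_length r i"
      "row_length l (j - size1 r) \<le> row_length l (i - size1 r)"
      using antimonoD[OF Node.IH(2)] antimonoD[OF Node.IH(1)] by (simp_all add: diff_le_mono)
    with \<open>i \<le> j\<close> show "row_length \<langle>l, x, r\<rangle> j \<le> row_length \<langle>l, x, r\<rangle> i"
      by auto
  qed
qed (simp add: antimono_def)

text \<open>Up to \<open>size r\<close> the left subtree contributes the constant
  \<open>size l\<close>, and beyond it the right subtree contributes 0. Each range thus reduces to
  the bound for one subtree.\<close>

lemma row_length_bound:
  assumes "i \<le> size T"
  shows "row_length T i + i \<le> size T"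
  using assms
proof (induction T arbitrary: i)
  case (Node l x r)
  show ?case
  proof (cases "i \<le> size r")
    case True
    with Node.IH(2)[of i] show ?thesis
      by (auto simp: size1_size)
  next
    case False
    have "row_length r i \<le> row_length r (size r)"
      using antimonoD[OF antimono_row_length, of "size r" i r] False by simp
    moreover have "row_length r (size r) = 0"
      using Node.IH(2)[of "size r"] by simp
    moreover have "i - size1 r \<le> size l"
      using Node.prems by (simp add: size1_size)
    ultimately show ?thesis
      using Node.IH(1)[of "i - size1 r"] False by (auto simp: size1_size)
  qed
qed simp

lemma row_length_eq_0: "size T \<le> i \<Longrightarrow> row_length T i = 0"
  using antimonoD[OF antimono_row_length, of "size T" i T] row_length_bound[of "size T" T] by simp

lemma row_length_in_extended_diagrams: "row_length T \<in> extended_diagrams (size T)"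
  by (simp add: extended_diagrams_def antimono_row_length row_length_bound)

section \<open>Reconstructing a tree from its row lengths\<close>

definition first_return :: "(nat \<Rightarrow> nat) \<Rightarrow> nat" where
  "first_return g = (LEAST j. j \<ge> 1 \<and> g j + j = g 0)"

text \<open>At \<open>size1 r\<close> only \<open>size l\<close> remains, which attains the bound.
  For smaller positive \<open>j\<close> the bound for \<open>r\<close> leaves the sum at most
  \<open>size l + size r\<close>, one short because of the root.\<close>

lemma first_return_row_length: "first_return (row_length \<langle>l, x, r\<rangle>) = size1 r"
  unfolding first_return_def
proof (rule Least_equality)
  show "size1 r \<ge> 1 \<and>
      row_length \<langle>l, x, r\<rangle> (size1 r) + size1 r = row_length \<langle>l, x, r\<rangle> 0"
    by (simp add: size1_size row_length_eq_0)
next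
  fix j
  assume j: "j \<ge> 1 \<and> row_length \<langle>l, x, r\<rangle> j + j = row_length \<langle>l, x, r\<rangle> 0"
  show "size1 r \<le> j"
  proof (rule ccontr)
    assume "\<not> size1 r \<le> j"
    then show False
      using j row_length_bound[of j r] by (auto simp: size1_size)
  qed
qed

lemma row_length_inject: "row_length T = row_length T' \<Longrightarrow> T = T'"
proof (induction T arbitrary: T')
  case Leaf
  then show ?case
    using fun_cong[OF Leaf, of 0] by simp
next
  case (Node l x r)
  have "T' \<noteq> \<langle>\<rangle>"
    using fun_cong[OF Node.prems, of 0] by auto
  then obtain l' r' where T': "T' = \<langle>l', (), r'\<rangle>"
    by (cases T') auto
  have eq: "row_length \<langle>l, x, r\<rangle> i = row_length \<langle>l', (), r'\<rangle> i" for i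
    using Node.prems[unfolded T'] by (rule fun_cong)
  have s: "size1 r = size1 r'"
    using first_return_row_length Node.prems T' by metis
  have l: "row_length l = row_length l'"
  proof
    fix i
    show "row_length l i = row_length l' i"
      \<comment> \<open>From \<open>size1 r\<close> on the right subtrees contribute 0, so the
        shifted rows show the left subtrees alone.\<close>
      using eq[of "i + size1 r"] s by (simp add: row_length_eq_0 size1_size)
  qed
  moreover have "row_length r = row_length r'"
  proof
    fix i
    show "row_length r i = row_length r' i"
      using eq[of i] s l by simp
  qed
  ultimately show ?case
    using Node.IH T' by simp
qed

text \<open>Cut \<open>g\<close> at its first return \<open>j\<close>: the part from
  \<open>j\<close> on yields \<open>l\<close>, the part before it, lowered by \<open>g j\<close>,
  yields \<open>r\<close>.\<close>

lemma ex_row_length: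
  assumes "g \<in> extended_diagrams n"
  shows "\<exists>T. row_length T = g"
  using assms
proof (induction n arbitrary: g rule: less_induct)
  case (less n)
  have g0: "g 0 = n" and anti: "i \<le> j \<Longrightarrow> g j \<le> g i" and bound: "i \<le> n \<Longrightarrow> g i + i \<le> n" for i j
    using less.prems by (auto simp: extended_diagrams_def antimono_def)
  show ?case
  proof (cases "n = 0")
    case True
    then have "row_length \<langle>\<rangle> = g"
      using anti[of 0] g0 by (auto simp: fun_eq_iff)
    then show ?thesis ..
  next
    case False
    define j where "j = first_return g"
    \<comment> \<open>The index \<open>n\<close> itself attains the bound, so the
      \<open>LEAST\<close> in \<open>first_return\<close> is over a nonempty set.\<close>
    have "n \<ge> 1 \<and> g n + n = g 0"
      using False bound[of n] g0 by simp
    then have "j \<ge> 1 \<and> g j + j = g 0"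
      unfolding j_def first_return_def by (rule LeastI)
    with g0 have j: "j \<ge> 1" "g j + j = n"
      by simp_all
    have strict: "g i + i < n" if "1 \<le> i" "i < j" for i
    proof -
      have "\<not> (i \<ge> 1 \<and> g i + i = g 0)"
        using that(2) unfolding j_def first_return_def by (rule not_less_Least)
      with that bound[of i] g0 j(2) show ?thesis
        by simp
    qed
    define gl where "gl i = g (i + j)" for i
    \<comment> \<open>At 0 the difference \<open>g 0 - g j\<close> would be \<open>j\<close>; one is
      taken off for the root. Past \<open>j\<close> the subtraction truncates to 0.\<close>
    define gr where "gr i = (if i = 0 then j - 1 else g i - g j)" for i
    have gr_le: "gr i + i \<le> j - 1" if "i \<le> j - 1" for i
    proof (cases "i = 0")
      case False
      \<comment> \<open>Strictness before the first return supplies the one unit that brings the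
        bound from \<open>j\<close> down to \<open>j - 1\<close>.\<close>
      then have "g i + i < n" "g j \<le> g i"
        using strict[of i] anti[of i j] that by auto
      with False show ?thesis
        using j by (simp add: gr_def)
    qed (simp add: gr_def)
    have gr_0: "gr i = 0" if "i \<ge> j" for i
      using that anti[of j i] j(1) by (simp add: gr_def)
    have "gl \<in> extended_diagrams (n - j)"
    proof -
      have "gl i + i \<le> n - j" if "i \<le> n - j" for i
        using bound[of "i + j"] that j(2) unfolding gl_def by linarith
      moreover have "gl 0 = n - j"
        using j(2) by (simp add: gl_def)
      ultimately show ?thesis
        using anti by (simp add: extended_diagrams_def antimono_def gl_def)
    qed
    then obtain l where l: "row_length l = gl"
      using less.IH[of "n - j" gl] j by auto
    have "gr \<in> extended_diagrams (j - 1)"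
    proof -
      have "gr b \<le> gr a" if "a \<le> b" for a b
      proof (cases "a = 0")
        case True
        have "gr b \<le> j - 1"
          using gr_le[of b] gr_0[of b] by linarith
        with True show ?thesis
          by (simp add: gr_def)
      next
        case False
        with that show ?thesis
          using anti[of a b] by (simp add: gr_def diff_le_mono)
      qed
      moreover have "gr 0 = j - 1"
        by (simp add: gr_def)
      ultimately show ?thesis
        using gr_le by (simp add: extended_diagrams_def antimono_def)
    qed
    moreover have "j - 1 < n"
      using j by linarith
    ultimately obtain r where r: "row_length r = gr"
      using less.IH by blast
    have s: "size1 r = j"
      using fun_cong[OF r, of 0] j(1) by (simp add: size1_size gr_def)
    have "row_length \<langle>l, (), r\<rangle> i = g i" for i
    proof -
      consider "i = 0" | "1 \<le> i" "i < j" | "j \<le> i"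
        by linarith
      then show ?thesis
      proof cases
        case 1
        then show ?thesis
          using j g0 fun_cong[OF l, of 0] fun_cong[OF r, of 0] by (simp add: gl_def gr_def)
      next
        case 2
        then show ?thesis
          using anti[of i j] fun_cong[OF l, of 0] by (simp add: l r s gl_def gr_def)
      next
        case 3
        then show ?thesis
          using gr_0[of i] j(1) by (simp add: l r s gl_def)
      qed
    qed
    then show ?thesis
      by blast
  qed
qed

lemma bij_betw_row_length: "bij_betw row_length {T. size T = n} (extended_diagrams n)"
  unfolding bij_betw_def
proof (intro conjI subset_antisym subsetI)
  show "inj_on row_length {T. size T = n}"
    by (simp add: inj_on_def row_length_inject)
next
  fix g
  assume "g \<in> row_length ` {T. size T = n}"
  then show "g \<in> extended_diagrams n"
    using row_length_in_extended_diagrams by auto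
next
  fix g
  assume g: "g \<in> extended_diagrams n"
  then obtain T where T: "row_length T = g"
    using ex_row_length by blast
  with g have "size T = n"
    using row_length_0[of T] by (simp add: extended_diagrams_def)
  with T show "g \<in> row_length ` {T. size T = n}"
    by blast
qed

section \<open>Exchanging the entry at index 0\<close>

lemma bounded_diagram_eq_0:
  assumes "n \<ge> 1" "d \<in> bounded_diagrams n" "i \<ge> n"
  shows "d i = 0"
proof -
  have "d i \<le> d n" "d n + n \<le> n"
    using assms unfolding bounded_diagrams_def young_diagram_def by auto
  then show ?thesis
    by simp
qed

lemma bij_betw_extended_bounded_diagrams:
  assumes "n \<ge> 1"
  shows "bij_betw (\<lambda>g. g(0 := 0)) (extended_diagrams n) (bounded_diagrams n)"
proof (rule bij_betw_byWitness[where f' = "\<lambda>d. d(0 := n)"])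
  show "\<forall>g \<in> extended_diagrams n. (g(0 := 0))(0 := n) = g"
    by (auto simp: extended_diagrams_def)
  show "\<forall>d \<in> bounded_diagrams n. (d(0 := n))(0 := 0) = d"
    by (auto simp: bounded_diagrams_def young_diagram_def fun_upd_idem)
  show "(\<lambda>g. g(0 := 0)) ` extended_diagrams n \<subseteq> bounded_diagrams n"
  proof safe
    fix g
    assume g: "g \<in> extended_diagrams n"
    have "g i = 0" if "i \<ge> n" for i
    proof -
      have "g i \<le> g n" "g n + n \<le> n"
        using g that by (auto simp: extended_diagrams_def antimono_def)
      then show ?thesis
        by simp
    qed
    then have "{i. (g(0 := 0)) i \<noteq> 0} \<subseteq> {..<n}"
      by (auto intro: ccontr)
    then have "finite {i. (g(0 := 0)) i \<noteq> 0}"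
      using finite_subset by blast
    then show "g(0 := 0) \<in> bounded_diagrams n"
      using g by (auto simp: bounded_diagrams_def young_diagram_def extended_diagrams_def antimono_def)
  qed
  show "(\<lambda>d. d(0 := n)) ` bounded_diagrams n \<subseteq> extended_diagrams n"
  proof safe
    fix d
    assume d: "d \<in> bounded_diagrams n"
    have bound: "d i + i \<le> n" if "1 \<le> i" "i \<le> n" for i
      using d that by (simp add: bounded_diagrams_def)
    \<comment> \<open>Comparison with the new entry \<open>n\<close> at index 0 is the one case of
      antitonicity that \<open>young_diagram\<close> does not supply.\<close>
    have "d i \<le> n" if "1 \<le> i" for i
      using bound[OF that] bounded_diagram_eq_0[OF assms d, of i] by (cases "i \<le> n") auto
    moreover have "d j \<le> d i" if "1 \<le> i" "i \<le> j" for i j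
      using d that by (simp add: bounded_diagrams_def young_diagram_def)
    ultimately have "antimono (d(0 := n))"
      by (auto simp: antimono_def)
    with bound show "d(0 := n) \<in> extended_diagrams n"
      by (simp add: extended_diagrams_def)
  qed
qed

theorem mainTheorem1:
  fixes n :: nat
  assumes "n \<ge> 1"
  shows "bij_betw bookshelf {T. size1 T = n + 1} (bounded_diagrams n) \<and>
         (\<forall>d \<in> bounded_diagrams n. \<forall>i \<ge> n. d i = 0)"
proof
  have "bookshelf = (\<lambda>g. g(0 := 0)) \<circ> row_length"
    by (simp add: fun_eq_iff bookshelf_eq_row_length)
  moreover have "{T :: binary_tree. size1 T = n + 1} = {T. size T = n}"
    by (simp add: size1_size)
  ultimately show "bij_betw bookshelf {T. size1 T = n + 1} (bounded_diagrams n)"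
    using bij_betw_trans[OF bij_betw_row_length bij_betw_extended_bounded_diagrams[OF assms]]
    by simp
  show "\<forall>d \<in> bounded_diagrams n. \<forall>i \<ge> n. d i = 0"
    using bounded_diagram_eq_0[OF assms] by blast
qed

end
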